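(* Let $k$ be a positive integer. For every positive integer $n$, $$p_k(n)=\frac{1}{n}\sum_{m=1}^n\sigma^{(k)}(m)\,p_k(n-m).$$
   Context: For $|q|<1$ write $(a;q)_\infty=\prod_{n\ge 0}(1-aq^n)$. For a positive integer $k$, $p_k(n)$ denotes the number of two-color partitions of $n$ in which one of the colors appears only in parts that are multiples of $k$; its generating function is $$\sum_{n\ge 0}p_k(n)q^n=\frac{1}{(q;q)_\infty(q^k;q^k)_\infty}=\prod_{j\ge 1}\frac{1}{(1-q^j)(1-q^{kj})},\quad |q|<1.$$ For a positive integer $n$, $\sigma^{(k)}(n)$ denotes the sum of the $k$-labeled divisors of $n$, meaning that divisors of $n$ that are multiples of $k$ have two labels and hence are counted twice; that is, $$\sigma^{(k)}(n)=\sum_{d\mid n}d+\sum_{\substack{d\mid n\\ k\mid d}}d,$$ the sums being over positive divisors $d$ of $n$. For example, $\sigma^{(2)}(4)=1+2+2+4+4=13$. *)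

theory Defs
  imports Complex_Main "HOL-Library.Multiset"
begin

datatype colour = Red | Blue

text \<open>
  A two-colour partition is a finite multiset of coloured positive parts \<open>(d, c)\<close>. Red parts are
  unrestricted; the blue parts are those that are required to be multiples of \<open>k\<close>. A multiple of
  \<open>k\<close> may thus occur in either colour.
\<close>
definition two_colour_partitions :: "nat \<Rightarrow> nat \<Rightarrow> (nat \<times> colour) multiset set" where
  "two_colour_partitions k n =
     {P. (\<forall>(d, c) \<in># P. 0 < d \<and> (c = Blue \<longrightarrow> k dvd d)) \<and> (\<Sum>(d, c) \<in># P. d) = n}"

definition p :: "nat \<Rightarrow> nat \<Rightarrow> nat" where
  "p k n = card (two_colour_partitions k n)"

text \<open>
  The sum of the \<open>k\<close>-labelled divisors, meant for \<open>n > 0\<close>: for \<open>n = 0\<close> and \<open>k > 0\<close> both index sets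
  are infinite and the value is \<open>0\<close> by the library's convention.
\<close>
definition sigma :: "nat \<Rightarrow> nat \<Rightarrow> nat" where
  "sigma k n = (\<Sum>d | d dvd n. d) + (\<Sum>d | d dvd n \<and> k dvd d. d)"

text \<open>The sets being counted are finite, so that \<open>card\<close> in the definition of \<open>p\<close> is a true count.\<close>
lemma finite_two_colour_partitions: "finite (two_colour_partitions k n)"
proof (rule finite_subset)
  have u: "(UNIV :: colour set) = {Red, Blue}"
    using colour.exhaust by auto
  have fin: "finite ({..n} \<times> (UNIV :: colour set))"
    by (simp add: u)
  show "finite (\<Union>s\<le>n. {P. set_mset P \<subseteq> {..n} \<times> (UNIV :: colour set) \<and> size P = s})"
  proof (intro finite_UN_I)
    fix s show "finite {P. set_mset P \<subseteq> {..n} \<times> (UNIV :: colour set) \<and> size P = s}"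
    proof (rule finite_subset)
      show "{P. set_mset P \<subseteq> {..n} \<times> (UNIV :: colour set) \<and> size P = s}
          \<subseteq> mset ` {xs. set xs \<subseteq> {..n} \<times> UNIV \<and> length xs = s}"
      proof
        fix P assume "P \<in> {P. set_mset P \<subseteq> {..n} \<times> (UNIV :: colour set) \<and> size P = s}"
        moreover obtain xs where "mset xs = P" using ex_mset by blast
        ultimately show "P \<in> mset ` {xs. set xs \<subseteq> {..n} \<times> UNIV \<and> length xs = s}"
          by (auto intro!: image_eqI[of _ _ xs])
      qed
      show "finite (mset ` {xs. set xs \<subseteq> {..n} \<times> (UNIV :: colour set) \<and> length xs = s})"
        using fin by (intro finite_imageI finite_lists_length_eq)
    qed
  qed simp
  show "two_colour_partitions k n
      \<subseteq> (\<Union>s\<le>n. {P. set_mset P \<subseteq> {..n} \<times> (UNIV :: colour set) \<and> size P = s})"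
  proof
    fix P assume P: "P \<in> two_colour_partitions k n"
    have pos: "0 < fst x" if "x \<in># P" for x
      using P that by (force simp: two_colour_partitions_def)
    have sm: "(\<Sum>x \<in># P. fst x) = n"
      using P by (simp add: two_colour_partitions_def case_prod_unfold)
    have "size P = (\<Sum>x \<in># P. 1)"
      by simp
    also have "\<dots> \<le> (\<Sum>x \<in># P. fst x)"
      by (rule sum_mset_mono) (use pos in \<open>simp add: Suc_le_eq\<close>)
    finally have "size P \<le> n"
      using sm by simp
    moreover have "fst x \<le> n" if x: "x \<in># P" for x
    proof -
      obtain Q where "P = add_mset x Q"
        using x by (meson multi_member_split)
      then show ?thesis
        using sm by simp
    qed
    then have "set_mset P \<subseteq> {..n} \<times> UNIV"
      by (auto simp: mem_Times_iff)
    ultimately show "P \<in> (\<Union>s\<le>n. {P. set_mset P \<subseteq> {..n} \<times> UNIV \<and> size P = s})"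
      by simp
  qed
qed

end

theory Submission imports Defs
begin

text \<open>
  The identity, multiplied by \<open>n\<close>, is a double count of the sum of all parts of all two-colour
  partitions of \<open>n\<close>. Each of these partitions contributes \<open>n\<close>, so the total is \<open>n * p k n\<close>.

  For the other side, call \<open>j > 0\<close> copies of a coloured part \<open>x\<close> of size \<open>d\<close> a block of weight
  \<open>m = d * j\<close>. A partition in which \<open>x\<close> has multiplicity \<open>c\<close> contains the blocks of \<open>x\<close> with
  \<open>1 \<le> j \<le> c\<close>, so counting \<open>d\<close> for each of them accounts for the parts \<open>x\<close>
  (\<open>sum_blocks_eq\<close>). A block is also determined by its weight \<open>m\<close> and by \<open>x\<close>, whose size divides
  \<open>m\<close>. Removing the block leaves an arbitrary two-colour partition of \<open>n - m\<close>, so exactly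
  \<open>p k (n - m)\<close> partitions contain it, a number that depends on \<open>m\<close> only
  (\<open>card_partitions_containing_block\<close>). For fixed \<open>m\<close> the sizes of the possible \<open>x\<close> add up to
  \<open>sigma k m\<close> (\<open>sum_coloured_divisors\<close>), which gives the convolution.
\<close>

text \<open>
  The two labels of a divisor that is a multiple of \<open>k\<close> are the two colours in which it may occur as
  a part, so \<open>sigma\<close> is a sum over a single set of coloured parts.
\<close>
definition coloured_divisors :: "nat \<Rightarrow> nat \<Rightarrow> (nat \<times> colour) set" where
  "coloured_divisors k m = {(d, c). d dvd m \<and> (c = Blue \<longrightarrow> k dvd d)}"

lemma coloured_divisors_eq:
  "coloured_divisors k m = (\<lambda>d. (d, Red)) ` {d. d dvd m} \<union> (\<lambda>d. (d, Blue)) ` {d. d dvd m \<and> k dvd d}"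
proof -
  have "c = Red \<or> c = Blue" for c :: colour
    by (cases c) auto
  then show ?thesis
    unfolding coloured_divisors_def by auto
qed

lemma finite_coloured_divisors: "m > 0 \<Longrightarrow> finite (coloured_divisors k m)"
  by (simp add: coloured_divisors_eq)

lemma sum_coloured_divisors:
  assumes "m > 0"
  shows "(\<Sum>x\<in>coloured_divisors k m. fst x) = sigma k m"
  unfolding coloured_divisors_eq sigma_def using assms
  by (subst sum.union_disjoint) (auto simp: sum.reindex inj_on_def)

lemma mem_two_colour_partitions:
  "P \<in> two_colour_partitions k n \<longleftrightarrow>
     (\<forall>x \<in># P. 0 < fst x \<and> (snd x = Blue \<longrightarrow> k dvd fst x)) \<and> (\<Sum>x \<in># P. fst x) = n"
  by (simp add: two_colour_partitions_def case_prod_unfold)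

text \<open>
  Removing or adding a block of \<open>j\<close> copies of \<open>x\<close> changes the sum of the parts by the weight of the
  block and keeps the partition admissible, because \<open>x\<close> is itself an admissible part.
\<close>
lemma card_partitions_containing_block:
  assumes x: "0 < fst x" "snd x = Blue \<longrightarrow> k dvd fst x" and le: "fst x * j \<le> n"
  shows "card {P \<in> two_colour_partitions k n. j \<le> count P x} = p k (n - fst x * j)"
proof -
  have "bij_betw (\<lambda>Q. Q + replicate_mset j x) (two_colour_partitions k (n - fst x * j))
          {P \<in> two_colour_partitions k n. j \<le> count P x}"
  proof (rule bij_betw_byWitness[where f' = "\<lambda>P. P - replicate_mset j x"])
    show "\<forall>Q\<in>two_colour_partitions k (n - fst x * j). Q + replicate_mset j x - replicate_mset j x = Q"
      by simp
    show "\<forall>P\<in>{P \<in> two_colour_partitions k n. j \<le> count P x}.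
            P - replicate_mset j x + replicate_mset j x = P"
      by (simp add: count_le_replicate_mset_subset_eq)
    show "(\<lambda>Q. Q + replicate_mset j x) ` two_colour_partitions k (n - fst x * j)
            \<subseteq> {P \<in> two_colour_partitions k n. j \<le> count P x}"
      using x le by (fastforce simp: mem_two_colour_partitions split: if_splits)
    show "(\<lambda>P. P - replicate_mset j x) ` {P \<in> two_colour_partitions k n. j \<le> count P x}
            \<subseteq> two_colour_partitions k (n - fst x * j)"
    proof (rule image_subsetI)
      fix P assume P: "P \<in> {P \<in> two_colour_partitions k n. j \<le> count P x}"
      then have "P = (P - replicate_mset j x) + replicate_mset j x"
        by (simp add: count_le_replicate_mset_subset_eq)
      then obtain Q where Q: "P = Q + replicate_mset j x"
        by blast
      show "P - replicate_mset j x \<in> two_colour_partitions k (n - fst x * j)"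
        using P unfolding Q by (auto simp: mem_two_colour_partitions)
    qed
  qed
  then show ?thesis
    unfolding p_def by (simp add: bij_betw_same_card)
qed

lemma sum_mset_eq_sum_count:
  fixes f :: "'a \<Rightarrow> nat"
  shows "(\<Sum>x \<in># M. f x) = (\<Sum>x\<in>set_mset M. count M x * f x)"
proof -
  \<comment> \<open>The induction runs over a fixed index set, since adding an element to \<open>M\<close> may or may not
    enlarge \<open>set_mset M\<close>.\<close>
  have "(\<Sum>x \<in># M. f x) = (\<Sum>x\<in>S. count M x * f x)" if "finite S" "set_mset M \<subseteq> S" for S
    using that(2)
  proof (induction M)
    case (add a M)
    have "(\<Sum>x\<in>S. count (add_mset a M) x * f x)
        = (\<Sum>x\<in>S. count M x * f x + (if x = a then f x else 0))"
      by (rule sum.cong) auto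
    also have "\<dots> = (\<Sum>x\<in>S. count M x * f x) + f a"
      using add.prems \<open>finite S\<close> by (simp add: sum.distrib)
    finally show ?case
      using add by simp
  qed simp
  then show ?thesis
    by simp
qed

text \<open>
  Each block contained in \<open>P\<close> is counted with the size of its part. Indexed by the part \<open>x\<close> and the
  number \<open>j\<close> of copies, the blocks give each part its size times its multiplicity,
  hence \<open>n\<close> in total; the double sum indexes them by the weight \<open>m = fst x * j\<close> and by \<open>x\<close>.
\<close>
lemma sum_blocks_eq:
  assumes P: "P \<in> two_colour_partitions k n"
  shows "(\<Sum>m = 1..n. \<Sum>x | x \<in> coloured_divisors k m \<and> m div fst x \<le> count P x. fst x) = n"
proof -
  have pos: "0 < fst x" and blue: "snd x = Blue \<longrightarrow> k dvd fst x" if "x \<in># P" for x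
    using P that by (auto simp: mem_two_colour_partitions)
  have sum: "(\<Sum>x \<in># P. fst x) = n"
    using P by (simp add: mem_two_colour_partitions)
  have le: "fst x * j \<le> n" if "j \<le> count P x" for x j
  proof -
    have "P = (P - replicate_mset j x) + replicate_mset j x"
      using that by (simp add: count_le_replicate_mset_subset_eq)
    then obtain Q where "P = Q + replicate_mset j x"
      by blast
    then show ?thesis
      using sum by (simp add: mult.commute)
  qed
  have div: "0 < fst x \<and> 0 < m div fst x \<and> fst x * (m div fst x) = m"
    if "x \<in> coloured_divisors k m" "m \<in> {1..n}" for x m
  proof -
    have d: "fst x dvd m" and m: "0 < m"
      using that by (auto simp: coloured_divisors_def)
    then have "0 < fst x" "fst x \<le> m"
      by (auto intro: dvd_pos_nat dvd_imp_le)
    then show ?thesis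
      using d by (simp add: div_greater_zero_iff)
  qed
  have "(\<Sum>m = 1..n. \<Sum>x | x \<in> coloured_divisors k m \<and> m div fst x \<le> count P x. fst x)
      = (\<Sum>(m, x)\<in>(SIGMA m:{1..n}. {x \<in> coloured_divisors k m. m div fst x \<le> count P x}). fst x)"
    using finite_coloured_divisors by (subst sum.Sigma) auto
  also have "\<dots> = (\<Sum>(x, j)\<in>(SIGMA x:set_mset P. {1..count P x}). fst x)"
  proof (rule sum.reindex_bij_witness[where
        i = "\<lambda>(x, j). (fst x * j, x)" and j = "\<lambda>(m, x). (x, m div fst x)"], goal_cases)
    case (1 a) then show ?case using div by fastforce
  next
    case (2 a)
    then obtain m x where a: "a = (m, x)" "m \<in> {1..n}" "x \<in> coloured_divisors k m"
      "m div fst x \<le> count P x" by blast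
    moreover have "0 < m div fst x"
      using div a by blast
    moreover from this have "x \<in># P"
      using a by (metis count_greater_zero_iff less_le_trans)
    ultimately show ?case
      by (simp add: Suc_le_eq)
  next
    case (3 b) then show ?case using pos by fastforce
  next
    case (4 b)
    then obtain x j where b: "b = (x, j)" "x \<in># P" "1 \<le> j" "j \<le> count P x" by auto
    then show ?case using pos[of x] blue[of x] le[of j x]
      by (auto simp: coloured_divisors_def case_prod_unfold Suc_le_eq)
  next
    case (5 a) then show ?case by auto
  qed
  also have "\<dots> = (\<Sum>x\<in>set_mset P. \<Sum>j = 1..count P x. fst x)"
    by (subst sum.Sigma) auto
  also have "\<dots> = (\<Sum>x \<in># P. fst x)"
    by (simp add: sum_mset_eq_sum_count)
  finally show ?thesis
    using sum by simp
qed

lemma times_p_eq_sum: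
  "n * p k n = (\<Sum>m = 1..n. sigma k m * p k (n - m))"
proof -
  let ?T = "two_colour_partitions k n"
  have T: "finite ?T"
    by (rule finite_two_colour_partitions)
  have "n * p k n = (\<Sum>P\<in>?T. \<Sum>m = 1..n.
          \<Sum>x | x \<in> coloured_divisors k m \<and> m div fst x \<le> count P x. fst x)"
    by (simp add: sum_blocks_eq p_def mult.commute del: One_nat_def)
  also have "\<dots> = (\<Sum>m = 1..n. \<Sum>P\<in>?T.
          \<Sum>x | x \<in> coloured_divisors k m \<and> m div fst x \<le> count P x. fst x)"
    by (rule sum.swap)
  also have "\<dots> = (\<Sum>m = 1..n. sigma k m * p k (n - m))"
  proof (rule sum.cong[OF refl])
    fix m assume m: "m \<in> {1..n}"
    have D: "finite (coloured_divisors k m)"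
      using m by (simp add: finite_coloured_divisors)
    have block: "card {P \<in> ?T. m div fst x \<le> count P x} = p k (n - m)"
      if "x \<in> coloured_divisors k m" for x
    proof -
      have d: "fst x dvd m" and "snd x = Blue \<longrightarrow> k dvd fst x"
        using that by (auto simp: coloured_divisors_def)
      moreover have "0 < fst x"
        using d m by (auto intro: dvd_pos_nat)
      ultimately show ?thesis
        using m card_partitions_containing_block[of x k "m div fst x" n] by simp
    qed
    have "(\<Sum>P\<in>?T. \<Sum>x | x \<in> coloured_divisors k m \<and> m div fst x \<le> count P x. fst x)
        = (\<Sum>x\<in>coloured_divisors k m. \<Sum>P | P \<in> ?T \<and> m div fst x \<le> count P x. fst x)"
      by (rule sum.swap_restrict[OF T D])
    also have "\<dots> = (\<Sum>x\<in>coloured_divisors k m. fst x * p k (n - m))"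
      by (simp add: block mult.commute)
    also have "\<dots> = sigma k m * p k (n - m)"
      using m by (simp add: sum_coloured_divisors flip: sum_distrib_right)
    finally show "(\<Sum>P\<in>?T. \<Sum>x | x \<in> coloured_divisors k m \<and> m div fst x \<le> count P x. fst x)
        = sigma k m * p k (n - m)" .
  qed
  finally show ?thesis .
qed

theorem theorem4p1:
  fixes k n :: nat
  assumes "k > 0" and "n > 0"
  shows "real (p k n) = 1 / real n * (\<Sum>m = 1..n. real (sigma k m) * real (p k (n - m)))"
proof -
  have "real n * real (p k n) = (\<Sum>m = 1..n. real (sigma k m) * real (p k (n - m)))"
    using arg_cong[OF times_p_eq_sum[of n k], of real] by simp
  then show ?thesis
    using assms by (simp add: field_simps)
qed

end
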